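(* Let $G$ be a countable discrete group. If $G$ is matricially stable, then each embeddable character of $G$ is a pointwise limit of traces of finite-dimensional representations of $G$.
   Context: Tracial ultraproducts: an ultrafilter $\alpha$ on $\mathbb N$ is nontrivial if it contains a sequence of sets $E_n$ with $\bigcap_n E_n=\varnothing$. For unital $C^*$-algebras $\mathcal A_i$ with tracial states $\rho_i$ ($i\in\mathbb N$), let $\|b\|_{2,\rho_i}=\rho_i(b^*b)^{1/2}$ and let $\prod_i\mathcal A_i$ be the $C^*$-algebra of norm-bounded sequences $(a_i)$, $a_i\in\mathcal A_i$, with the supremum norm. The tracial ultraproduct $\prod_{i\in\mathbb N}^{\alpha}(\mathcal A_i,\rho_i)$ is the quotient of $\prod_i\mathcal A_i$ by the ideal of all $(a_i)$ with $\lim_{i\to\alpha}\|a_i\|_{2,\rho_i}=0$; the coset of $(a_i)$ is written $\{a_i\}_\alpha$. It carries the faithful tracial state $\rho_\alpha(\{a_i\}_\alpha)=\lim_{i\to\alpha}\rho_i(a_i)$. $\mathcal U(\mathcal A)$ denotes the unitary group of $\mathcal A$. Stability: $G$ is matricially stable if for every nontrivial ultrafilter $\alpha$ on $\mathbb N$ and every sequence of full matrix algebras $\mathcal A_i=M_{k_i}(\mathbb C)$ with their normalized traces $\rho_i$, each group homomorphism $f:G\to\mathcal U(\prod_{i\in\mathbb N}^{\alpha}(\mathcal A_i,\rho_i))$ is liftable, i.e. there are homomorphisms $f_i:G\to\mathcal U(\mathcal A_i)$, $i\in\mathbb N$, with $f(g)=\{f_i(g)\}_\alpha$ for all $g\in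 G$. Characters: a character of $G$ is a positive definite function $\tau:G\to\mathbb C$ that is constant on conjugacy classes and satisfies $\tau(e)=1$. A character $\tau$ is embeddable if there are a nontrivial ultrafilter $\alpha$ on $\mathbb N$ and a homomorphism $f:G\to\mathcal U(\prod_{n\in\mathbb N}^{\alpha}(M_n(\mathbb C),tr_n))$, where $tr_n$ is the normalized trace on $M_n(\mathbb C)$, with $\tau=\tau_\alpha\circ f$, where $\tau_\alpha(\{a_n\}_\alpha)=\lim_{n\to\alpha}tr_n(a_n)$. The trace of a finite-dimensional (unitary) representation $\pi:G\to\mathcal U(M_n(\mathbb C))$ is the function $g\mapsto tr_n(\pi(g))$ (normalized trace). *)

theory Defs
  imports
    Complex_Main
    "HOL-Library.Countable_Set"
    "HOL-Algebra.QuotRing"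
    "Jordan_Normal_Form.Schur_Decomposition"
begin

section \<open>Nontrivial ultrafilters on the natural numbers\<close>

text \<open>A set \<open>E\<close> belongs to the filter \<open>\<alpha>\<close> iff \<open>eventually (\<lambda>i. i \<in> E) \<alpha>\<close>; limits
  along \<open>\<alpha>\<close> are then the library's filter limits.\<close>

definition ultrafilter :: "nat filter \<Rightarrow> bool" where
  "ultrafilter \<alpha> \<longleftrightarrow>
     \<alpha> \<noteq> bot \<and> (\<forall>E. eventually (\<lambda>i. i \<in> E) \<alpha> \<or> eventually (\<lambda>i. i \<notin> E) \<alpha>)"

definition nontrivial_ultrafilter :: "nat filter \<Rightarrow> bool" where
  "nontrivial_ultrafilter \<alpha> \<longleftrightarrow>
     ultrafilter \<alpha> \<and>
     (\<exists>E :: nat \<Rightarrow> nat set. (\<forall>n. eventually (\<lambda>i. i \<in> E n) \<alpha>) \<and> (\<Inter>n. E n) = {})"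


section \<open>Tracial ultraproducts\<close>

text \<open>These records only carry the operations that the construction uses (scalar multiplication
  plays no role in it); all instances below are built from full matrix algebras.\<close>

record 'a star_ring = "'a ring" +
  star :: "'a \<Rightarrow> 'a"

record 'a normed_star_ring = "'a star_ring" +
  cnorm :: "'a \<Rightarrow> real"

definition unitary_group :: "('a, 'b) star_ring_scheme \<Rightarrow> 'a monoid" where
  "unitary_group A =
     \<lparr>carrier = {u \<in> carrier A. star A u \<otimes>\<^bsub>A\<^esub> u = \<one>\<^bsub>A\<^esub> \<and> u \<otimes>\<^bsub>A\<^esub> star A u = \<one>\<^bsub>A\<^esub>},
      monoid.mult = monoid.mult A,
      one = \<one>\<^bsub>A\<^esub>\<rparr>"

definition norm2 :: "('a, 'b) star_ring_scheme \<Rightarrow> ('a \<Rightarrow> complex) \<Rightarrow> 'a \<Rightarrow> real" where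
  "norm2 A \<rho> b = sqrt (Re (\<rho> (star A b \<otimes>\<^bsub>A\<^esub> b)))"

definition bounded_product :: "(nat \<Rightarrow> ('a, 'b) normed_star_ring_scheme) \<Rightarrow> (nat \<Rightarrow> 'a) star_ring" where
  "bounded_product A =
     \<lparr>carrier = {a. (\<forall>i. a i \<in> carrier (A i)) \<and> bdd_above (range (\<lambda>i. cnorm (A i) (a i)))},
      monoid.mult = (\<lambda>a b i. a i \<otimes>\<^bsub>A i\<^esub> b i),
      one = (\<lambda>i. \<one>\<^bsub>A i\<^esub>),
      zero = (\<lambda>i. \<zero>\<^bsub>A i\<^esub>),
      add = (\<lambda>a b i. a i \<oplus>\<^bsub>A i\<^esub> b i),
      star = (\<lambda>a i. star (A i) (a i))\<rparr>"

definition null_ideal ::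
  "nat filter \<Rightarrow> (nat \<Rightarrow> ('a, 'b) normed_star_ring_scheme) \<Rightarrow> (nat \<Rightarrow> 'a \<Rightarrow> complex) \<Rightarrow> (nat \<Rightarrow> 'a) set" where
  "null_ideal \<alpha> A \<rho> =
     {a \<in> carrier (bounded_product A). ((\<lambda>i. norm2 (A i) (\<rho> i) (a i)) \<longlongrightarrow> 0) \<alpha>}"

text \<open>The involution of the quotient maps the coset of \<open>a\<close> to the coset of \<open>a\<^sup>*\<close>, that is, it takes
  the image of a coset under the involution of the product.\<close>

definition tracial_ultraproduct ::
  "nat filter \<Rightarrow> (nat \<Rightarrow> ('a, 'b) normed_star_ring_scheme) \<Rightarrow> (nat \<Rightarrow> 'a \<Rightarrow> complex)
     \<Rightarrow> (nat \<Rightarrow> 'a) set star_ring" where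
  "tracial_ultraproduct \<alpha> A \<rho> =
     ring.extend (bounded_product A Quot null_ideal \<alpha> A \<rho>)
       (star_ring.fields (\<lambda>X. star (bounded_product A) ` X))"

definition ultra_coset ::
  "nat filter \<Rightarrow> (nat \<Rightarrow> ('a, 'b) normed_star_ring_scheme) \<Rightarrow> (nat \<Rightarrow> 'a \<Rightarrow> complex)
     \<Rightarrow> (nat \<Rightarrow> 'a) \<Rightarrow> (nat \<Rightarrow> 'a) set" where
  "ultra_coset \<alpha> A \<rho> a = null_ideal \<alpha> A \<rho> +>\<^bsub>bounded_product A\<^esub> a"

text \<open>The limit does not depend on the representative \<open>a\<close> of the coset \<open>X\<close>.\<close>

definition ultra_trace ::
  "nat filter \<Rightarrow> (nat \<Rightarrow> 'a \<Rightarrow> complex) \<Rightarrow> (nat \<Rightarrow> 'a) set \<Rightarrow> complex" where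
  "ultra_trace \<alpha> \<rho> X = (THE l. \<forall>a\<in>X. ((\<lambda>i. \<rho> i (a i)) \<longlongrightarrow> l) \<alpha>)"


section \<open>Full matrix algebras\<close>

definition op_norm :: "complex mat \<Rightarrow> real" where
  "op_norm A =
     (SUP v \<in> {v \<in> carrier_vec (dim_col A). v \<bullet>c v = 1}. sqrt (Re ((A *\<^sub>v v) \<bullet>c (A *\<^sub>v v))))"

definition normalized_trace :: "complex mat \<Rightarrow> complex" where
  "normalized_trace A = (\<Sum>i<dim_row A. A $$ (i, i)) / of_nat (dim_row A)"

definition matrix_algebra :: "nat \<Rightarrow> complex mat normed_star_ring" where
  "matrix_algebra n =
     \<lparr>carrier = carrier_mat n n, monoid.mult = (*), one = 1\<^sub>m n, zero = 0\<^sub>m n n, add = (+),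
      star = mat_adjoint, cnorm = op_norm\<rparr>"


section \<open>Matricial stability and characters\<close>

definition matricially_stable :: "('g, 'm) monoid_scheme \<Rightarrow> bool" where
  "matricially_stable G \<longleftrightarrow>
     (\<forall>\<alpha> (k :: nat \<Rightarrow> nat). nontrivial_ultrafilter \<alpha> \<longrightarrow> (\<forall>i. 1 \<le> k i) \<longrightarrow>
        (let A = \<lambda>i. matrix_algebra (k i); \<rho> = \<lambda>i. normalized_trace in
         \<forall>f \<in> hom G (unitary_group (tracial_ultraproduct \<alpha> A \<rho>)).
           \<exists>F. (\<forall>i. F i \<in> hom G (unitary_group (A i))) \<and>
               (\<forall>g \<in> carrier G. f g = ultra_coset \<alpha> A \<rho> (\<lambda>i. F i g))))"

definition positive_definite :: "('g, 'm) monoid_scheme \<Rightarrow> ('g \<Rightarrow> complex) \<Rightarrow> bool" where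
  "positive_definite G \<tau> \<longleftrightarrow>
     (\<forall>S c. finite S \<longrightarrow> S \<subseteq> carrier G \<longrightarrow>
        (let s = (\<Sum>g\<in>S. \<Sum>h\<in>S. cnj (c g) * c h * \<tau> (inv\<^bsub>G\<^esub> g \<otimes>\<^bsub>G\<^esub> h)) in
         Im s = 0 \<and> 0 \<le> Re s))"

definition group_character :: "('g, 'm) monoid_scheme \<Rightarrow> ('g \<Rightarrow> complex) \<Rightarrow> bool" where
  "group_character G \<tau> \<longleftrightarrow>
     positive_definite G \<tau> \<and>
     (\<forall>g \<in> carrier G. \<forall>h \<in> carrier G. \<tau> (h \<otimes>\<^bsub>G\<^esub> g \<otimes>\<^bsub>G\<^esub> inv\<^bsub>G\<^esub> h) = \<tau> g) \<and>
     \<tau> \<one>\<^bsub>G\<^esub> = 1"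

text \<open>The algebras \<open>M\<^sub>n(\<complex>)\<close> with \<open>n = 1, 2, \<dots>\<close> are indexed by \<open>nat\<close> through \<open>n = Suc i\<close>.\<close>

definition embeddable :: "('g, 'm) monoid_scheme \<Rightarrow> ('g \<Rightarrow> complex) \<Rightarrow> bool" where
  "embeddable G \<tau> \<longleftrightarrow>
     (\<exists>\<alpha>. nontrivial_ultrafilter \<alpha> \<and>
        (let A = \<lambda>i. matrix_algebra (Suc i); \<rho> = \<lambda>i. normalized_trace in
         \<exists>f \<in> hom G (unitary_group (tracial_ultraproduct \<alpha> A \<rho>)).
           \<forall>g \<in> carrier G. \<tau> g = ultra_trace \<alpha> \<rho> (f g)))"

end

theory Submission
  imports Defs "HOL-Analysis.Topology_Euclidean_Space" "HOL-Analysis.Convex"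
begin

text \<open>By stability the homomorphism \<open>f\<close> witnessing embeddability lifts to unitary representations
  \<open>F\<^sub>i\<close>. Since \<open>\<bar>tr b\<bar> \<le> \<parallel>b\<parallel>\<^sub>2\<close>, the trace of the coset of \<open>(F\<^sub>i g)\<close> is the limit along \<open>\<alpha>\<close> of
  \<open>tr (F\<^sub>i g)\<close>. Hence finitely many values of \<open>\<tau>\<close> can be approximated simultaneously by a single
  \<open>tr \<circ> F\<^sub>i\<close>, and an enumeration of \<open>G\<close> turns these approximations into a convergent sequence.\<close>

text \<open>Compactness of \<open>K\<close> gives the image filter
  \<open>filtermap f \<alpha>\<close> a cluster point \<open>l\<close>. Since an ultrafilter decides
  the preimage of every open set, a neighbourhood of \<open>l\<close> whose preimage is not in
  \<open>\<alpha>\<close> would have a complement in the image filter, so \<open>l\<close> could not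
  be a cluster point; hence \<open>l\<close> is a limit.\<close>

lemma ultrafilter_compact_convergent:
  fixes f :: "nat \<Rightarrow> 'a :: topological_space"
  assumes "ultrafilter \<alpha>" and "compact K" and "eventually (\<lambda>i. f i \<in> K) \<alpha>"
  obtains l where "(f \<longlongrightarrow> l) \<alpha>"
proof -
  have nb: "filtermap f \<alpha> \<noteq> bot"
    using assms(1) by (simp add: ultrafilter_def filtermap_bot_iff)
  have "eventually (\<lambda>x. x \<in> K) (filtermap f \<alpha>)"
    using assms(3) by (simp add: eventually_filtermap)
  then obtain l where l: "inf (nhds l) (filtermap f \<alpha>) \<noteq> bot"
    using nb assms(2) unfolding compact_filter by blast
  have "(f \<longlongrightarrow> l) \<alpha>"
  proof (rule topological_tendstoI, rule ccontr)
    fix S assume S: "open S" "l \<in> S" and "\<not> eventually (\<lambda>i. f i \<in> S) \<alpha>"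
    moreover have "eventually (\<lambda>i. i \<in> f -` S) \<alpha> \<or> eventually (\<lambda>i. i \<notin> f -` S) \<alpha>"
      using assms(1) unfolding ultrafilter_def by blast
    ultimately have "eventually (\<lambda>x. x \<notin> S) (filtermap f \<alpha>)"
      by (simp add: eventually_filtermap)
    moreover have "eventually (\<lambda>x. x \<in> S) (nhds l)"
      using S eventually_nhds by blast
    ultimately have "eventually (\<lambda>x. False) (inf (nhds l) (filtermap f \<alpha>))"
      unfolding eventually_inf by blast
    then show False using l by (simp add: trivial_limit_def)
  qed
  then show thesis by (rule that)
qed

lemma adjoint_mult_diag:
  assumes "b \<in> carrier_mat n n" and "i < n"
  shows "(mat_adjoint b * b) $$ (i, i) = of_real (\<Sum>j<n. (cmod (b $$ (j, i)))\<^sup>2)"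
  using assms
  by (simp add: mat_adjoint_def scalar_prod_def mat_of_rows_index atLeast0LessThan
      complex_norm_square mult.commute del: of_real_power)

text \<open>The trace of \<open>mat_adjoint b * b\<close> sums the squared moduli of all entries of
  \<open>b\<close>. It thus dominates the diagonal part, which Cauchy-Schwarz against the constant
  vector 1 compares with the squared sum of the diagonal moduli.\<close>

lemma cmod_trace_le_norm2:
  assumes b: "b \<in> carrier_mat n n"
  shows "cmod (normalized_trace b) \<le> norm2 (matrix_algebra n) normalized_trace b"
proof -
  let ?s = "\<Sum>i<n. cmod (b $$ (i, i))"
  have "Re (normalized_trace (mat_adjoint b * b))
      = (\<Sum>i<n. \<Sum>j<n. (cmod (b $$ (j, i)))\<^sup>2) / n"
    using b adjoint_mult_diag[OF b]
    by (simp add: normalized_trace_def mat_adjoint_def Re_divide_of_nat del: of_real_sum)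
  moreover have "(\<Sum>i<n. (cmod (b $$ (i, i)))\<^sup>2) \<le> (\<Sum>i<n. \<Sum>j<n. (cmod (b $$ (j, i)))\<^sup>2)"
    by (intro sum_mono member_le_sum) auto
  moreover have "?s\<^sup>2 \<le> (\<Sum>i<n. (cmod (b $$ (i, i)))\<^sup>2) * n"
    using Cauchy_Schwarz_ineq_sum[of "\<lambda>i. cmod (b $$ (i, i))" "\<lambda>_. 1" "{..<n}"] by simp
  ultimately have "(?s / n)\<^sup>2 \<le> Re (normalized_trace (mat_adjoint b * b))"
    \<comment> \<open>For \<open>n = 0\<close> both sides are 0, because division by 0 yields
      0.\<close>
    by (cases "n = 0") (auto simp: power_divide power2_eq_square[of "real n"] field_simps
        intro: order_trans mult_left_mono)
  moreover have "cmod (normalized_trace b) \<le> ?s / n"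
    using b by (auto simp: normalized_trace_def norm_divide intro!: divide_right_mono norm_sum)
  ultimately show ?thesis
    by (auto simp: norm2_def matrix_algebra_def intro: order_trans real_le_rsqrt)
qed

lemma cmod_trace_unitary_le_1:
  assumes "u \<in> carrier (unitary_group (matrix_algebra n))"
  shows "cmod (normalized_trace u) \<le> 1"
proof -
  have u: "u \<in> carrier_mat n n" "mat_adjoint u * u = 1\<^sub>m n"
    using assms by (auto simp: unitary_group_def matrix_algebra_def)
  \<comment> \<open>The 2-norm is 1 for positive \<open>n\<close> and 0 for \<open>n = 0\<close>,
    hence only an inequality.\<close>
  have "norm2 (matrix_algebra n) normalized_trace u \<le> 1"
    using u(2) by (simp add: norm2_def matrix_algebra_def normalized_trace_def)
  then show ?thesis using cmod_trace_le_norm2[OF u(1)] by linarith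
qed

lemma op_norm_zero:
  assumes "n > 0"
  shows "op_norm (0\<^sub>m n n) = 0"
proof -
  let ?V = "{v \<in> carrier_vec n. v \<bullet>c v = (1 :: complex)}"
  \<comment> \<open>Positive dimension enters here: it keeps the supremum from ranging over the
    empty set.\<close>
  have "unit_vec n 0 \<in> ?V"
    using assms by simp
  moreover have "sqrt (Re ((0\<^sub>m n n *\<^sub>v v) \<bullet>c (0\<^sub>m n n *\<^sub>v v))) = 0" if "v \<in> ?V" for v
  proof -
    have "0\<^sub>m n n *\<^sub>v v = 0\<^sub>v n"
      using that by (intro eq_vecI) (auto simp: scalar_prod_def)
    then show ?thesis by simp
  qed
  ultimately have "(\<lambda>v. sqrt (Re ((0\<^sub>m n n *\<^sub>v v) \<bullet>c (0\<^sub>m n n *\<^sub>v v)))) ` ?V = {0}"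
    by force
  then show ?thesis by (simp add: op_norm_def)
qed

text \<open>This makes every coset nonempty, without which the definite description in
  \<open>ultra_trace\<close> would not single out a value.\<close>

lemma zero_mem_null_ideal:
  assumes "\<And>i. 1 \<le> k i"
  shows "(\<lambda>i. 0\<^sub>m (k i) (k i)) \<in> null_ideal \<alpha> (\<lambda>i. matrix_algebra (k i)) (\<lambda>i. normalized_trace)"
proof -
  have "op_norm (0\<^sub>m (k i) (k i)) = 0" for i
    using op_norm_zero[of "k i"] assms[of i] by simp
  moreover have "norm2 (matrix_algebra n) normalized_trace (0\<^sub>m n n) = 0" for n
    by (simp add: norm2_def matrix_algebra_def normalized_trace_def mat_adjoint_def)
  ultimately show ?thesis
    by (simp add: null_ideal_def bounded_product_def) (simp add: matrix_algebra_def)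
qed

text \<open>Traces of unitaries stay in the closed unit disc, so they converge along \<alpha>. Any
  other representative of the coset differs from \<open>u\<close> by a 2-norm null sequence, whose
  traces tend to 0, so the limit belongs to the coset.\<close>

lemma tendsto_ultra_trace:
  assumes uf: "ultrafilter \<alpha>" and k: "\<And>i. 1 \<le> k i"
    and u: "\<And>i. u i \<in> carrier (unitary_group (matrix_algebra (k i)))"
  shows "((\<lambda>i. normalized_trace (u i)) \<longlongrightarrow>
     ultra_trace \<alpha> (\<lambda>i. normalized_trace)
       (ultra_coset \<alpha> (\<lambda>i. matrix_algebra (k i)) (\<lambda>i. normalized_trace) u)) \<alpha>"
proof -
  let ?I = "null_ideal \<alpha> (\<lambda>i. matrix_algebra (k i)) (\<lambda>i. normalized_trace)"
  let ?X = "ultra_coset \<alpha> (\<lambda>i. matrix_algebra (k i)) (\<lambda>i. normalized_trace) u"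
  have uc: "u i \<in> carrier_mat (k i) (k i)" for i
    using u[of i] by (simp add: unitary_group_def matrix_algebra_def)
  have X: "?X = (\<lambda>x i. x i + u i) ` ?I"
    by (auto simp: ultra_coset_def a_r_coset_def r_coset_def bounded_product_def matrix_algebra_def)
  have "eventually (\<lambda>i. normalized_trace (u i) \<in> cball 0 1) \<alpha>"
    using cmod_trace_unitary_le_1[OF u] by (intro always_eventually) (simp add: dist_norm)
  then obtain l where l: "((\<lambda>i. normalized_trace (u i)) \<longlongrightarrow> l) \<alpha>"
    by (rule ultrafilter_compact_convergent[OF uf compact_cball])
  have lim: "((\<lambda>i. normalized_trace (a i)) \<longlongrightarrow> l) \<alpha>" if aX: "a \<in> ?X" for a
  proof -
    obtain x where x: "x \<in> ?I" and a: "a = (\<lambda>i. x i + u i)"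
      using aX unfolding X by blast
    have xc: "x i \<in> carrier_mat (k i) (k i)" for i
      using x by (simp add: null_ideal_def bounded_product_def matrix_algebra_def)
    have "((\<lambda>i. norm2 (matrix_algebra (k i)) normalized_trace (x i)) \<longlongrightarrow> 0) \<alpha>"
      using x by (simp add: null_ideal_def)
    then have "((\<lambda>i. normalized_trace (x i)) \<longlongrightarrow> 0) \<alpha>"
      by (rule Lim_null_comparison[rotated]) (simp add: cmod_trace_le_norm2[OF xc])
    from tendsto_add[OF this l] show ?thesis
      using carrier_matD[OF uc] carrier_matD[OF xc]
      by (simp add: a normalized_trace_def sum.distrib add_divide_distrib)
  qed
  \<comment> \<open>Uniqueness of the described limit needs both a proper filter and a
    representative to test.\<close>
  have "\<alpha> \<noteq> bot" using uf by (simp add: ultrafilter_def)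
  moreover obtain a where "a \<in> ?X" using zero_mem_null_ideal[of k, OF k] X by blast
  ultimately have "ultra_trace \<alpha> (\<lambda>i. normalized_trace) ?X = l"
    unfolding ultra_trace_def using lim by (blast intro: the_equality tendsto_unique)
  then show ?thesis using l by simp
qed

text \<open>A diagonal choice: \<open>r n\<close> serves the finitely many points numbered at most
  \<open>n\<close> with error below \<open>1/(n+1)\<close>. Such an index exists because finitely
  many eventual conditions hold jointly, and what holds eventually along a proper filter holds
  somewhere.\<close>

lemma countable_pointwise_limit_sequence:
  fixes t :: "'i \<Rightarrow> 'g \<Rightarrow> 'b :: metric_space"
  assumes "F \<noteq> bot" and "countable S" and lim: "\<And>g. g \<in> S \<Longrightarrow> ((\<lambda>i. t i g) \<longlongrightarrow> \<tau> g) F"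
  obtains r :: "nat \<Rightarrow> 'i" where "\<And>g. g \<in> S \<Longrightarrow> (\<lambda>n. t (r n) g) \<longlonglongrightarrow> \<tau> g"
proof -
  let ?T = "\<lambda>n. {g \<in> S. to_nat_on S g \<le> n}"
  have "finite (?T n)" for n
    using inj_on_subset[OF inj_on_to_nat_on[OF assms(2)], of "?T n"]
    by (auto intro: inj_on_finite[of _ _ "{..n}"])
  then have "eventually (\<lambda>i. \<forall>g\<in>?T n. dist (t i g) (\<tau> g) < inverse (Suc n)) F" for n
    using lim by (intro eventually_ball_finite) (auto intro!: tendstoD)
  then have "\<exists>i. \<forall>g\<in>?T n. dist (t i g) (\<tau> g) < inverse (Suc n)" for n
    using eventually_happens'[OF assms(1)] by blast
  then obtain r where r: "\<And>n g. g \<in> ?T n \<Longrightarrow> dist (t (r n) g) (\<tau> g) < inverse (Suc n)"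
    by metis
  have "(\<lambda>n. t (r n) g) \<longlonglongrightarrow> \<tau> g" if g: "g \<in> S" for g
  proof (rule tendsto_dist_iff[THEN iffD2])
    \<comment> \<open>The point \<open>g\<close> is controlled at every stage from its own number
      on.\<close>
    have "\<forall>\<^sub>F n in sequentially. norm (dist (t (r n) g) (\<tau> g)) \<le> inverse (real (Suc n))"
      using r g by (auto simp: eventually_sequentially intro!: exI[of _ "to_nat_on S g"] less_imp_le)
    then show "(\<lambda>n. dist (t (r n) g) (\<tau> g)) \<longlonglongrightarrow> 0"
      by (rule Lim_null_comparison[OF _ LIMSEQ_inverse_real_of_nat])
  qed
  then show thesis by (rule that)
qed

theorem theorem3:
  fixes G :: "('g, 'm) monoid_scheme" and \<tau> :: "'g \<Rightarrow> complex"
  assumes "group G" and "countable (carrier G)"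
    and "matricially_stable G"
    and "group_character G \<tau>" and "embeddable G \<tau>"
  shows "\<exists>(d :: nat \<Rightarrow> nat) (\<pi> :: nat \<Rightarrow> 'g \<Rightarrow> complex mat).
           (\<forall>n. 1 \<le> d n \<and> \<pi> n \<in> hom G (unitary_group (matrix_algebra (d n)))) \<and>
           (\<forall>g \<in> carrier G. (\<lambda>n. normalized_trace (\<pi> n g)) \<longlonglongrightarrow> \<tau> g)"
proof -
  let ?A = "\<lambda>i. matrix_algebra (Suc i)" and ?\<rho> = "\<lambda>i :: nat. normalized_trace"
  obtain \<alpha> f where \<alpha>: "nontrivial_ultrafilter \<alpha>"
    and f: "f \<in> hom G (unitary_group (tracial_ultraproduct \<alpha> ?A ?\<rho>))"
    and \<tau>: "\<And>g. g \<in> carrier G \<Longrightarrow> \<tau> g = ultra_trace \<alpha> ?\<rho> (f g)"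
    using assms(5) unfolding embeddable_def Let_def by blast
  \<comment> \<open>Embeddability uses the algebra of size \<open>i + 1\<close> at index
    \<open>i\<close>, so stability is applied with \<open>Suc\<close> as the sequence of
    sizes.\<close>
  have "\<forall>i. 1 \<le> Suc i" by simp
  then obtain F where F: "\<And>i. F i \<in> hom G (unitary_group (?A i))"
    and fF: "\<And>g. g \<in> carrier G \<Longrightarrow> f g = ultra_coset \<alpha> ?A ?\<rho> (\<lambda>i. F i g)"
    using assms(3)[unfolded matricially_stable_def Let_def, rule_format, of \<alpha> Suc f] \<alpha> f by auto
  have uf: "ultrafilter \<alpha>" using \<alpha> by (simp add: nontrivial_ultrafilter_def)
  have "((\<lambda>i. normalized_trace (F i g)) \<longlongrightarrow> \<tau> g) \<alpha>" if "g \<in> carrier G" for g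
    unfolding \<tau>[OF that] fF[OF that]
    by (rule tendsto_ultra_trace[OF uf]) (use F that in \<open>auto simp: hom_def\<close>)
  then obtain r where "\<And>g. g \<in> carrier G \<Longrightarrow> (\<lambda>n. normalized_trace (F (r n) g)) \<longlonglongrightarrow> \<tau> g"
    using countable_pointwise_limit_sequence[of \<alpha> "carrier G" "\<lambda>i g. normalized_trace (F i g)" \<tau>]
      uf assms(2) unfolding ultrafilter_def by metis
  then show ?thesis
    \<comment> \<open>The representation \<open>F (r n)\<close> takes its values in matrices of size
      \<open>Suc (r n)\<close>.\<close>
    using F by (intro exI[of _ "\<lambda>n. Suc (r n)"] exI[of _ "\<lambda>n. F (r n)"]) auto
qed

end
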